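(* If there exists a function $f=(f_n)_{n\ge1}$, $f_n:\{0,1\}^n\times\{0,1\}^n\to\{0,1\}$, in $\mathbf{P}$ that has superpolynomial garden-hose complexity (i.e. $GH(f_n)$ is not bounded by any polynomial in $n$), then $\mathbf{P}\ne\mathbf{L}$.
   Context: $\mathbf{P}$ and $\mathbf{L}$ are the classes of problems decidable by deterministic Turing machines in polynomial time and in logarithmic (work-tape) space, respectively; $f$ is viewed as a decision problem on inputs $(x,y)$ of total length $2n$. Garden-hose game of size $s\in\mathbb{N}$: let $A=\{1^A,\dots,s^A\}$, $B=\{1^B,\dots,s^B\}$, $A_\circ=A\cup\{0\}$, and $E=\{\{i^A,i^B\}:1\le i\le s\}$ (the pipes). A game $G$ is given by functions $E_{A_\circ},E_B$ on $\{0,1\}^n$, where $E_{A_\circ}(x)$ is a set of edges (no self-loops) on $A_\circ$ and $E_B(y)$ is a set of edges (no self-loops) on $B$, such that the graphs $(A_\circ,E_{A_\circ}(x))$ and $(B,E_B(y))$ have maximum degree at most $1$. Put $G(x,y)=(A_\circ\cup B,\,E\cup E_{A_\circ}(x)\cup E_B(y))$. There is a unique maximal path $\pi(x,y)$ in $G(x,y)$ starting at $0$ (it consists of $0$ alone if $0$ has degree $0$). $G$ computes a function $h:\{0,1\}^n\times\{0,1\}^n\to\{0,1\}$ if for all $x,y$ the endpoint of $\pi(x,y)$ lies in $A_\circ$ when $h(x,y)=0$ and in $B$ when $h(x,y)=1$. $GH(h)$ is the smallest size $s$ of a game computing $h$. *)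

theory Defs
  imports
    "HOL-Library.Sublist"
    "HOL-Library.Landau_Symbols"
    "HOL-Computational_Algebra.Polynomial"
begin

section \<open>Deterministic Turing machines, polynomial time and logarithmic space\<close>

text \<open>
  The machine model is the usual one for sublinear space: a two-way read-only input tape
  \<open>\<turnstile> w \<stileturn>\<close> that the input head never leaves, and one read-write work tape that is infinite
  to the right.  States and work-tape symbols are initial segments of the natural numbers, so that
  all machines live in a single type; work-tape symbol \<open>0\<close> is the blank.
\<close>

datatype input_symbol = Left_End | Bit bool | Right_End

datatype direction = To_Left | Stay | To_Right

record tm =
  num_states :: nat
  num_symbols :: nat
  start_state :: nat
  accept_state :: nat
  reject_state :: nat
  delta :: "nat \<Rightarrow> input_symbol \<Rightarrow> nat \<Rightarrow> nat \<times> nat \<times> direction \<times> direction"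
    \<comment> \<open>new state, symbol written on the work tape, move of the input head, move of the work head\<close>

definition valid_tm :: "tm \<Rightarrow> bool" where
  "valid_tm M \<longleftrightarrow>
     0 < num_symbols M \<and>
     start_state M < num_states M \<and> accept_state M < num_states M \<and>
     reject_state M < num_states M \<and> accept_state M \<noteq> reject_state M \<and>
     (\<forall>q a b. q < num_states M \<longrightarrow> b < num_symbols M \<longrightarrow>
        (case delta M q a b of (q', b', d, e) \<Rightarrow> q' < num_states M \<and> b' < num_symbols M))"

record config =
  state :: nat
  input_pos :: nat
  work_tape :: "nat \<Rightarrow> nat"
  work_pos :: nat

definition read_input :: "bool list \<Rightarrow> nat \<Rightarrow> input_symbol" where
  "read_input w i =
     (if i = 0 then Left_End else if i \<le> length w then Bit (w ! (i - 1)) else Right_End)"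

text \<open>A head that is told to move left from cell \<open>0\<close> stays there, because \<open>0 - 1 = 0\<close>.\<close>

fun move_head :: "direction \<Rightarrow> nat \<Rightarrow> nat" where
  "move_head To_Left i = i - 1"
| "move_head Stay i = i"
| "move_head To_Right i = i + 1"

definition initial_config :: "tm \<Rightarrow> config" where
  "initial_config M = \<lparr>state = start_state M, input_pos = 0, work_tape = (\<lambda>_. 0), work_pos = 0\<rparr>"

definition halted :: "tm \<Rightarrow> config \<Rightarrow> bool" where
  "halted M c \<longleftrightarrow> state c = accept_state M \<or> state c = reject_state M"

definition tm_step :: "tm \<Rightarrow> bool list \<Rightarrow> config \<Rightarrow> config" where
  "tm_step M w c =
     (if halted M c then c
      else case delta M (state c) (read_input w (input_pos c)) (work_tape c (work_pos c)) of
        (q, b, d, e) \<Rightarrow>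
          \<lparr>state = q,
           input_pos = min (move_head d (input_pos c)) (length w + 1),
           work_tape = (work_tape c)(work_pos c := b),
           work_pos = move_head e (work_pos c)\<rparr>)"

definition run :: "tm \<Rightarrow> bool list \<Rightarrow> nat \<Rightarrow> config" where
  "run M w t = (tm_step M w ^^ t) (initial_config M)"

definition decides :: "tm \<Rightarrow> bool list set \<Rightarrow> bool" where
  "decides M X \<longleftrightarrow>
     (\<forall>w. (\<exists>t. halted M (run M w t)) \<and>
          (w \<in> X \<longleftrightarrow> (\<exists>t. state (run M w t) = accept_state M)))"

definition time_bounded :: "tm \<Rightarrow> (nat \<Rightarrow> nat) \<Rightarrow> bool" where
  "time_bounded M T \<longleftrightarrow> (\<forall>w. \<exists>t \<le> T (length w). halted M (run M w t))"

text \<open>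
  The work head starts in cell \<open>0\<close> and moves by at most one cell per step, so the following says
  that at most \<open>S (length w)\<close> work-tape cells are ever scanned.
\<close>

definition space_bounded :: "tm \<Rightarrow> (nat \<Rightarrow> nat) \<Rightarrow> bool" where
  "space_bounded M S \<longleftrightarrow> (\<forall>w t. work_pos (run M w t) < S (length w))"

definition PTIME :: "bool list set set" where
  "PTIME = {X. \<exists>M (p :: nat poly). valid_tm M \<and> decides M X \<and> time_bounded M (poly p)}"

definition LOGSPACE :: "bool list set set" where
  "LOGSPACE =
     {X. \<exists>M S. valid_tm M \<and> decides M X \<and> space_bounded M S \<and>
           (\<lambda>n. real (S n)) \<in> O(\<lambda>n. ln (real n))}"


section \<open>Functions on pairs of bit strings as decision problems\<close>

text \<open>
  A family \<open>f\<^sub>n : {0,1}\<^sup>n \<times> {0,1}\<^sup>n \<rightarrow> {0,1}\<close> is represented by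
  \<open>f :: nat \<Rightarrow> bool list \<Rightarrow> bool list \<Rightarrow> bool\<close>; everything below depends on \<open>f n x y\<close> only for
  \<open>n \<ge> 1\<close> and \<open>length x = n = length y\<close>.  The input \<open>(x, y)\<close> is the concatenation of \<open>x\<close> and
  \<open>y\<close>, which determines \<open>x\<close> and \<open>y\<close> since they have the same length.
\<close>

definition decision_problem :: "(nat \<Rightarrow> bool list \<Rightarrow> bool list \<Rightarrow> bool) \<Rightarrow> bool list set" where
  "decision_problem f =
     {x @ y | n x y. n \<ge> 1 \<and> length x = n \<and> length y = n \<and> f n x y}"


section \<open>The garden-hose game\<close>

datatype vertex = Tap | Pipe_A nat | Pipe_B nat \<comment> \<open>\<open>Tap\<close> is the vertex \<open>0\<close>\<close>

definition A_vertices :: "nat \<Rightarrow> vertex set" where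
  "A_vertices s = Pipe_A ` {1..s}"

definition A0_vertices :: "nat \<Rightarrow> vertex set" where
  "A0_vertices s = insert Tap (A_vertices s)"

definition B_vertices :: "nat \<Rightarrow> vertex set" where
  "B_vertices s = Pipe_B ` {1..s}"

definition pipe_edges :: "nat \<Rightarrow> vertex set set" where
  "pipe_edges s = (\<lambda>i. {Pipe_A i, Pipe_B i}) ` {1..s}"

definition simple_edges_on :: "'v set \<Rightarrow> 'v set set \<Rightarrow> bool" where
  "simple_edges_on V E \<longleftrightarrow> E \<subseteq> {{u, v} | u v. u \<in> V \<and> v \<in> V \<and> u \<noteq> v}"

definition max_degree_le_1 :: "'v set \<Rightarrow> 'v set set \<Rightarrow> bool" where
  "max_degree_le_1 V E \<longleftrightarrow> (\<forall>v\<in>V. card {e \<in> E. v \<in> e} \<le> 1)"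

record game =
  edges_A :: "bool list \<Rightarrow> vertex set set"
  edges_B :: "bool list \<Rightarrow> vertex set set"

definition garden_hose_game :: "nat \<Rightarrow> nat \<Rightarrow> game \<Rightarrow> bool" where
  "garden_hose_game n s G \<longleftrightarrow>
     (\<forall>x. length x = n \<longrightarrow>
        simple_edges_on (A0_vertices s) (edges_A G x) \<and>
        max_degree_le_1 (A0_vertices s) (edges_A G x)) \<and>
     (\<forall>y. length y = n \<longrightarrow>
        simple_edges_on (B_vertices s) (edges_B G y) \<and>
        max_degree_le_1 (B_vertices s) (edges_B G y))"

definition game_vertices :: "nat \<Rightarrow> vertex set" where
  "game_vertices s = A0_vertices s \<union> B_vertices s"

definition game_edges :: "nat \<Rightarrow> game \<Rightarrow> bool list \<Rightarrow> bool list \<Rightarrow> vertex set set" where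
  "game_edges s G x y = pipe_edges s \<union> edges_A G x \<union> edges_B G y"

definition path_from :: "'v set \<Rightarrow> 'v set set \<Rightarrow> 'v \<Rightarrow> 'v list \<Rightarrow> bool" where
  "path_from V E v p \<longleftrightarrow>
     p \<noteq> [] \<and> hd p = v \<and> set p \<subseteq> V \<and> distinct p \<and> successively (\<lambda>a b. {a, b} \<in> E) p"

definition maximal_path_from :: "'v set \<Rightarrow> 'v set set \<Rightarrow> 'v \<Rightarrow> 'v list \<Rightarrow> bool" where
  "maximal_path_from V E v p \<longleftrightarrow>
     path_from V E v p \<and> (\<forall>q. path_from V E v q \<longrightarrow> prefix p q \<longrightarrow> q = p)"

text \<open>The description is justified by \<open>ex1_maximal_path\<close> below.\<close>

definition water_path :: "nat \<Rightarrow> game \<Rightarrow> bool list \<Rightarrow> bool list \<Rightarrow> vertex list" where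
  "water_path s G x y =
     (THE p. maximal_path_from (game_vertices s) (game_edges s G x y) Tap p)"

definition computes ::
  "nat \<Rightarrow> nat \<Rightarrow> game \<Rightarrow> (bool list \<Rightarrow> bool list \<Rightarrow> bool) \<Rightarrow> bool" where
  "computes n s G h \<longleftrightarrow>
     (\<forall>x y. length x = n \<longrightarrow> length y = n \<longrightarrow>
        last (water_path s G x y) \<in> (if h x y then B_vertices s else A0_vertices s))"

definition GH :: "nat \<Rightarrow> (bool list \<Rightarrow> bool list \<Rightarrow> bool) \<Rightarrow> nat" where
  "GH n h = (LEAST s. \<exists>G. garden_hose_game n s G \<and> computes n s G h)"

definition superpolynomial_GH :: "(nat \<Rightarrow> bool list \<Rightarrow> bool list \<Rightarrow> bool) \<Rightarrow> bool" where
  "superpolynomial_GH f \<longleftrightarrow> \<not> (\<exists>p :: nat poly. \<forall>n\<ge>1. GH n (f n) \<le> poly p n)"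


subsection \<open>The maximal path is well defined\<close>

lemma max_degree_unique:
  assumes "simple_edges_on V E" "max_degree_le_1 V E" "finite V"
    and "{v, a} \<in> E" "{v, b} \<in> E"
  shows "a = b"
proof -
  have sub: "E \<subseteq> Pow V" using assms(1) by (auto simp: simple_edges_on_def)
  then have fin: "finite {e \<in> E. v \<in> e}"
    using assms(3) by (auto intro: finite_subset[of _ "Pow V"])
  have "v \<in> V" using sub assms(4) by auto
  then have "card {e \<in> E. v \<in> e} \<le> 1" using assms(2) by (auto simp: max_degree_le_1_def)
  then have "{v, a} = {v, b}"
    using assms(4,5) fin by (auto simp: card_le_Suc0_iff_eq)
  then show ?thesis by (metis doubleton_eq_iff)
qed

context
  fixes n s :: nat and G :: game and x y :: "bool list"
  assumes game: "garden_hose_game n s G" and lx: "length x = n" and ly: "length y = n"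
begin

private abbreviation "EE \<equiv> game_edges s G x y"

private lemma A_unique: "{v, a} \<in> edges_A G x \<Longrightarrow> {v, b} \<in> edges_A G x \<Longrightarrow> a = b"
  using game lx max_degree_unique[of "A0_vertices s" "edges_A G x" v a b]
  by (auto simp: garden_hose_game_def A0_vertices_def A_vertices_def)

private lemma B_unique: "{v, a} \<in> edges_B G y \<Longrightarrow> {v, b} \<in> edges_B G y \<Longrightarrow> a = b"
  using game ly max_degree_unique[of "B_vertices s" "edges_B G y" v a b]
  by (auto simp: garden_hose_game_def B_vertices_def)

private lemma A_sub: "e \<in> edges_A G x \<Longrightarrow> e \<subseteq> A0_vertices s"
  using game lx by (fastforce simp: garden_hose_game_def simple_edges_on_def)

private lemma B_sub: "e \<in> edges_B G y \<Longrightarrow> e \<subseteq> B_vertices s"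
  using game ly by (fastforce simp: garden_hose_game_def simple_edges_on_def)

private lemma neighbours:
  assumes "{v, u} \<in> EE"
  shows "case v of Tap \<Rightarrow> {v, u} \<in> edges_A G x
    | Pipe_A i \<Rightarrow> u = Pipe_B i \<or> {v, u} \<in> edges_A G x
    | Pipe_B i \<Rightarrow> u = Pipe_A i \<or> {v, u} \<in> edges_B G y"
proof -
  consider i where "{v, u} = {Pipe_A i, Pipe_B i}" | "{v, u} \<in> edges_A G x" | "{v, u} \<in> edges_B G y"
    using assms by (auto simp: game_edges_def pipe_edges_def)
  then show ?thesis
  proof cases
    case 1
    then show ?thesis by (auto simp: doubleton_eq_iff)
  next
    case 2
    then show ?thesis
      using A_sub[OF 2] by (auto simp: A0_vertices_def A_vertices_def)
  next
    case 3
    then show ?thesis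
      using B_sub[OF 3] by (auto simp: B_vertices_def)
  qed
qed

private lemma degree_Tap: "{Tap, a} \<in> EE \<Longrightarrow> {Tap, b} \<in> EE \<Longrightarrow> a = b"
  using neighbours[of Tap a] neighbours[of Tap b] A_unique by auto

private lemma degree_le_2:
  "{v, a} \<in> EE \<Longrightarrow> {v, b} \<in> EE \<Longrightarrow> {v, c} \<in> EE \<Longrightarrow> c \<noteq> a \<Longrightarrow> c \<noteq> b \<Longrightarrow> a = b"
  using neighbours[of v a] neighbours[of v b] neighbours[of v c]
  by (cases v; simp; metis A_unique B_unique)

private abbreviation "is_path \<equiv> path_from (game_vertices s) EE Tap"

private lemma paths_agree:
  assumes p: "is_path p" and q: "is_path q"
  shows "i < length p \<Longrightarrow> i < length q \<Longrightarrow> p ! i = q ! i"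
proof (induction i rule: less_induct)
  case (less i)
  have edge: "{r ! j, r ! Suc j} \<in> EE" if "is_path r" "Suc j < length r" for r j
    using that by (auto simp: path_from_def successively_conv_nth)
  show ?case
  proof (cases i)
    case 0
    then show ?thesis using p q by (auto simp: path_from_def hd_conv_nth)
  next
    case (Suc j)
    then have eq: "p ! j = q ! j" using less by auto
    have e: "{p ! j, p ! i} \<in> EE" "{p ! j, q ! i} \<in> EE"
      using edge[OF p, of j] edge[OF q, of j] less.prems Suc eq by auto
    show ?thesis
    proof (cases j)
      case 0
      then have "p ! j = Tap" using p by (auto simp: path_from_def hd_conv_nth)
      then show ?thesis using e degree_Tap by auto
    next
      case (Suc k)
      have eq': "p ! k = q ! k" using less Suc \<open>i = Suc j\<close> by auto
      have "{p ! j, p ! k} \<in> EE"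
        using edge[OF p, of k] less.prems Suc \<open>i = Suc j\<close> by (auto simp: insert_commute)
      moreover have "p ! k \<noteq> p ! i" "p ! k \<noteq> q ! i"
        using p q less.prems Suc \<open>i = Suc j\<close> eq'
        by (auto simp: path_from_def nth_eq_iff_index_eq)
      ultimately show ?thesis using degree_le_2[OF e] by auto
    qed
  qed
qed

private lemma paths_prefix:
  assumes p: "is_path p" and q: "is_path q" and "length p \<le> length q"
  shows "prefix p q"
proof -
  have "p = take (length p) q"
    using paths_agree[OF p q] assms(3) by (intro nth_equalityI) auto
  then show ?thesis by (metis take_is_prefix)
qed

lemma ex1_maximal_path:
  "\<exists>!p. maximal_path_from (game_vertices s) (game_edges s G x y) Tap p"
proof (rule ex_ex1I)
  have fin: "finite (game_vertices s)"
    by (auto simp: game_vertices_def A0_vertices_def A_vertices_def B_vertices_def)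
  have bound: "length p \<le> card (game_vertices s)" if "is_path p" for p
    using that fin by (metis path_from_def card_mono distinct_card)
  have "is_path [Tap]" by (auto simp: path_from_def game_vertices_def A0_vertices_def)
  then obtain p where p: "is_path p" "\<forall>q. is_path q \<longrightarrow> length q \<le> length p"
    using ex_has_greatest_nat[of is_path "[Tap]" length "Suc (card (game_vertices s))"] bound
    by (metis less_Suc_eq_le)
  then have "maximal_path_from (game_vertices s) EE Tap p"
    unfolding maximal_path_from_def
    by (meson paths_prefix prefix_order.antisym)
  then show "\<exists>p. maximal_path_from (game_vertices s) EE Tap p" ..
next
  fix p q
  assume "maximal_path_from (game_vertices s) EE Tap p" "maximal_path_from (game_vertices s) EE Tap q"
  then show "p = q"
    unfolding maximal_path_from_def
    using paths_prefix[of p q] paths_prefix[of q p] by (metis nat_le_linear)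
qed

end

end

theory Submission
  imports Defs "HOL-Library.FuncSet"
begin

text \<open>
  If \<open>f\<close> is in \<open>L\<close>, then the configurations of a machine for \<open>f\<close> on inputs of length \<open>2n\<close>
  are polynomially many, say \<open>N\<close>, and each of them reads a bit known to one of the players.  Pairs of
  a time in \<open>{0..N}\<close> and a configuration, joined by the transitions, form a forest whose roots are
  the pairs with time \<open>N\<close>.  Water has to be routed reversibly, so it cannot just follow the run, but
  it can make an Euler tour of the tree of the initial configuration (as in the theorem of Lange,
  McKenzie and Tapp), which ends in the root, i.e. in the outcome of the run.  The tour alternates
  between a fixed matching, which moves on to the next potential predecessor of a vertex, and a
  matching that depends on the input, each of whose edges depends on a single configuration's
  transition and can thus be laid by the player who knows the bit read there.  Hence \<open>GH(f\<^sub>n)\<close> is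
  polynomial.
\<close>

section \<open>Games given by involutions\<close>

text \<open>A repeated vertex would have three distinct neighbours: its predecessor and successor on
  \<open>p\<close>, and \<open>last p\<close>. At the start, which has no predecessor, two are
  already too many; \<open>nonback\<close> excludes the one case in which the successor is
  \<open>last p\<close> itself.\<close>

lemma path_from_snoc:
  assumes p: "path_from V E v p" and u: "{last p, u} \<in> E" "u \<in> V" "u \<noteq> last p"
    and start: "\<And>a b. {v, a} \<in> E \<Longrightarrow> {v, b} \<in> E \<Longrightarrow> a = b"
    and deg: "\<And>w a b c. w \<in> V \<Longrightarrow> {w, a} \<in> E \<Longrightarrow> {w, b} \<in> E \<Longrightarrow> {w, c} \<in> E \<Longrightarrow> c \<noteq> a \<Longrightarrow> c \<noteq> b \<Longrightarrow> a = b"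
    and nonback: "2 \<le> length p \<Longrightarrow> u \<noteq> p ! (length p - 2)"
  shows "path_from V E v (p @ [u])"
proof -
  have ne: "p \<noteq> []" and d: "distinct p" and hd: "hd p = v" and V: "set p \<subseteq> V"
    and succ: "successively (\<lambda>a b. {a, b} \<in> E) p"
    using p by (auto simp: path_from_def)
  have edge: "{p ! i, p ! Suc i} \<in> E" if "Suc i < length p" for i
    using succ that by (auto simp: successively_conv_nth)
  have last: "last p = p ! (length p - 1)" using ne by (simp add: last_conv_nth)
  have "u \<notin> set p"
  proof
    assume "u \<in> set p"
    then obtain j where j: "j < length p" "p ! j = u" by (auto simp: in_set_conv_nth)
    have jl: "j \<noteq> length p - 1" using u(3) j last by auto
    have jb: "Suc j \<noteq> length p - 1"
    proof
      assume "Suc j = length p - 1"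
      then have "j = length p - 2" "2 \<le> length p" by auto
      then show False using nonback j by blast
    qed
    have sj: "Suc j < length p" using j jl by auto
    have e: "{u, p ! Suc j} \<in> E" "{u, last p} \<in> E"
      using edge[OF sj] j u(1) by (auto simp: insert_commute)
    have neq: "last p \<noteq> p ! Suc j"
      using d jb sj last by (auto simp: nth_eq_iff_index_eq)
    show False
    proof (cases j)
      case 0
      then show False using start e neq j hd ne by (auto simp: hd_conv_nth)
    next
      case (Suc i)
      have "{u, p ! i} \<in> E" using edge[of i] Suc j by (auto simp: insert_commute)
      moreover have "p ! i \<noteq> p ! Suc j" "p ! i \<noteq> last p"
        using d Suc sj j last by (auto simp: nth_eq_iff_index_eq)
      ultimately show False using deg[OF u(2)] e neq by metis
    qed
  qed
  then show ?thesis
    using p u by (auto simp: path_from_def successively_append_iff)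
qed

lemma maximal_path_fromI:
  assumes p: "path_from V E v p" and nb: "\<And>u. {last p, u} \<in> E \<Longrightarrow> u \<in> set p"
  shows "maximal_path_from V E v p"
  unfolding maximal_path_from_def
proof (intro conjI allI impI)
  fix q assume q: "path_from V E v q" and "prefix p q"
  then obtain r where r: "q = p @ r" by (auto elim: prefixE)
  show "q = p"
  proof (cases r)
    case (Cons u r')
    then have "{last p, u} \<in> E" "u \<notin> set p"
      using p q r by (auto simp: path_from_def successively_append_iff)
    then show ?thesis using nb by auto
  qed (use r in simp)
qed (rule p)

text \<open>
  \<open>\<alpha>\<close> and \<open>\<beta>\<close> are the connections of Alice and Bob, a fixed point being an open end; \<open>None\<close> is the
  tap.  The first argument of \<open>outlet\<close> is an end on Alice's side which the water has reached
  from the other side (or the tap), the second one tells whether it flows out on Bob's side.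
\<close>

inductive outlet :: "('i option \<Rightarrow> 'i option) \<Rightarrow> ('i \<Rightarrow> 'i) \<Rightarrow> 'i option \<Rightarrow> bool \<Rightarrow> bool"
  for \<alpha> \<beta> where
  Alice: "\<alpha> a = a \<Longrightarrow> outlet \<alpha> \<beta> a False"
| Bob: "\<alpha> a = Some i \<Longrightarrow> \<alpha> a \<noteq> a \<Longrightarrow> \<beta> i = i \<Longrightarrow> outlet \<alpha> \<beta> a True"
| flow: "\<alpha> a = Some i \<Longrightarrow> \<alpha> a \<noteq> a \<Longrightarrow> \<beta> i \<noteq> i \<Longrightarrow> outlet \<alpha> \<beta> (Some (\<beta> i)) b \<Longrightarrow> outlet \<alpha> \<beta> a b"

section \<open>Involutions as edge sets of maximum degree one\<close>

definition matching :: "('i \<Rightarrow> vertex) \<Rightarrow> 'i set \<Rightarrow> ('i \<Rightarrow> 'i) \<Rightarrow> vertex set set" where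
  "matching g I \<mu> = {{g i, g (\<mu> i)} | i. i \<in> I \<and> \<mu> i \<noteq> i}"

lemma matching_neighbour:
  assumes "inj_on g I" "\<And>i. i \<in> I \<Longrightarrow> \<mu> i \<in> I \<and> \<mu> (\<mu> i) = i" "i \<in> I"
  shows "{g i, w} \<in> matching g I \<mu> \<longleftrightarrow> w = g (\<mu> i) \<and> \<mu> i \<noteq> i"
proof
  assume "{g i, w} \<in> matching g I \<mu>"
  then obtain j where j: "j \<in> I" "\<mu> j \<noteq> j" "{g i, w} = {g j, g (\<mu> j)}"
    by (auto simp: matching_def)
  then consider "g i = g j" "w = g (\<mu> j)" | "g i = g (\<mu> j)" "w = g j"
    by (auto simp: doubleton_eq_iff)
  then show "w = g (\<mu> i) \<and> \<mu> i \<noteq> i"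
  proof cases
    case 1
    then have "i = j" using assms j by (auto dest: inj_onD)
    then show ?thesis using 1 j by auto
  next
    case 2
    then have "i = \<mu> j" using assms j by (auto dest: inj_onD)
    then show ?thesis using 2 j assms(2)[OF j(1)] by auto
  qed
qed (use assms in \<open>auto simp: matching_def\<close>)

lemma matching_simple:
  assumes "inj_on g I" "\<And>i. i \<in> I \<Longrightarrow> \<mu> i \<in> I \<and> \<mu> (\<mu> i) = i"
  shows "simple_edges_on (g ` I) (matching g I \<mu>)"
  using assms unfolding simple_edges_on_def matching_def by (fastforce dest: inj_onD)

lemma matching_degree:
  assumes "inj_on g I" "\<And>i. i \<in> I \<Longrightarrow> \<mu> i \<in> I \<and> \<mu> (\<mu> i) = i"
  shows "max_degree_le_1 (g ` I) (matching g I \<mu>)"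
  unfolding max_degree_le_1_def
proof
  fix v assume "v \<in> g ` I"
  then obtain i where i: "i \<in> I" "v = g i" by auto
  have "e = {g i, g (\<mu> i)}" if e: "e \<in> matching g I \<mu>" "v \<in> e" for e
  proof -
    obtain j where "e = {g j, g (\<mu> j)}" using e by (auto simp: matching_def)
    then have "e = {g i, if g i = g j then g (\<mu> j) else g j}" using e(2) i by auto
    then obtain w where "e = {g i, w}" by blast
    then show ?thesis using matching_neighbour[OF assms i(1), where w=w] e by auto
  qed
  then have "{e \<in> matching g I \<mu>. v \<in> e} \<subseteq> {{g i, g (\<mu> i)}}" by auto
  then show "card {e \<in> matching g I \<mu>. v \<in> e} \<le> 1"
    using card_mono[of "{{g i, g (\<mu> i)}}"] by auto
qed

text \<open>An arbitrary finite index set lets pipes be named by structured data, and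
  \<open>outlet\<close> hides the paths: by induction on it, every passage extends the water path,
  and an open end makes that path maximal.\<close>

theorem GH_le_involutions:
  fixes \<alpha> :: "bool list \<Rightarrow> 'i option \<Rightarrow> 'i option" and \<beta> :: "bool list \<Rightarrow> 'i \<Rightarrow> 'i"
  assumes fin: "finite I"
    and \<alpha>: "\<And>x a. a \<in> insert None (Some ` I) \<Longrightarrow> \<alpha> x a \<in> insert None (Some ` I) \<and> \<alpha> x (\<alpha> x a) = a"
    and \<beta>: "\<And>y i. i \<in> I \<Longrightarrow> \<beta> y i \<in> I \<and> \<beta> y (\<beta> y i) = i"
    and h: "\<And>x y. length x = n \<Longrightarrow> length y = n \<Longrightarrow> outlet (\<alpha> x) (\<beta> y) None (h x y)"
  shows "GH n h \<le> card I"
proof -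
  let ?s = "card I" and ?I = "insert None (Some ` I)"
  obtain e where e: "bij_betw e I {1..?s}"
    using fin by (metis bij_betw_iff_card card_atLeastAtMost diff_Suc_1 finite_atLeastAtMost)
  define A where "A = case_option Tap (\<lambda>i. Pipe_A (e i))"
  define B where "B = (\<lambda>i. Pipe_B (e i))"
  have injA: "inj_on A ?I" and injB: "inj_on B I"
    using e by (auto simp: A_def B_def inj_on_def bij_betw_def)
  have e_im: "e ` I = {1..?s}" using e by (simp add: bij_betw_def)
  have imA: "A ` ?I = A0_vertices ?s" and imB: "B ` I = B_vertices ?s"
    unfolding A_def B_def A0_vertices_def A_vertices_def B_vertices_def e_im[symmetric]
    by (auto simp: image_image)
  define G where "G = \<lparr>edges_A = \<lambda>x. matching A ?I (\<alpha> x), edges_B = \<lambda>y. matching B I (\<beta> y)\<rparr>"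
  have "simple_edges_on (A ` ?I) (matching A ?I (\<alpha> x)) \<and> max_degree_le_1 (A ` ?I) (matching A ?I (\<alpha> x))" for x
    using matching_simple[OF injA \<alpha>[of _ x]] matching_degree[OF injA \<alpha>[of _ x]] by blast
  moreover have "simple_edges_on (B ` I) (matching B I (\<beta> y)) \<and> max_degree_le_1 (B ` I) (matching B I (\<beta> y))" for y
    using matching_simple[OF injB \<beta>[of _ y]] matching_degree[OF injB \<beta>[of _ y]] by blast
  ultimately have game: "garden_hose_game n ?s G"
    unfolding garden_hose_game_def imA[symmetric] imB[symmetric] by (simp add: G_def)
  have "computes n ?s G h"
    unfolding computes_def
  proof (intro allI impI)
    fix x y :: "bool list" assume lx: "length x = n" and ly: "length y = n"
    let ?V = "game_vertices ?s" and ?E = "game_edges ?s G x y"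
    have V: "?V = A ` ?I \<union> B ` I" by (simp only: game_vertices_def imA imB)
    have E: "?E = (\<lambda>i. {A (Some i), B i}) ` I \<union> matching A ?I (\<alpha> x) \<union> matching B I (\<beta> y)"
      unfolding game_edges_def pipe_edges_def e_im[symmetric]
      by (simp add: A_def B_def G_def image_image)
    have AB: "A a \<noteq> B i" for a i by (auto simp: A_def B_def split: option.splits)
    have mA: "{B i, w} \<notin> matching A ?I (\<alpha> x)" for i w
      using AB by (auto simp: matching_def doubleton_eq_iff) (metis AB)+
    have mB: "{A a, w} \<notin> matching B I (\<beta> y)" for a w
      using AB by (auto simp: matching_def doubleton_eq_iff)
    have EA: "{A a, w} \<in> ?E \<longleftrightarrow> w = A (\<alpha> x a) \<and> \<alpha> x a \<noteq> a \<or> (\<exists>i. a = Some i \<and> w = B i)"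
      if "a \<in> ?I" for a w
    proof -
      have "{A a, w} \<in> (\<lambda>i. {A (Some i), B i}) ` I \<longleftrightarrow> (\<exists>i. a = Some i \<and> w = B i)"
        using that bij_betw_imp_inj_on[OF e]
        by (cases a) (auto simp: doubleton_eq_iff A_def B_def inj_on_eq_iff image_iff)
      then show ?thesis
        using matching_neighbour[OF injA \<alpha>[of _ x] that, where w=w] mB by (auto simp: E)
    qed
    have EB: "{B i, w} \<in> ?E \<longleftrightarrow> w = B (\<beta> y i) \<and> \<beta> y i \<noteq> i \<or> w = A (Some i)"
      if "i \<in> I" for i w
    proof -
      have "{B i, w} \<in> (\<lambda>i. {A (Some i), B i}) ` I \<longleftrightarrow> w = A (Some i)"
        using that AB[symmetric] injB by (auto simp: doubleton_eq_iff inj_on_def)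
      then show ?thesis
        using matching_neighbour[OF injB \<beta>[of _ y] that, where w=w] mA by (auto simp: E)
    qed
    have start: "a = b" if "{Tap, a} \<in> ?E" "{Tap, b} \<in> ?E" for a b
      using EA[of None a] EA[of None b] that by (simp add: A_def)
    have deg: "a = b" if "w \<in> ?V" "{w, a} \<in> ?E" "{w, b} \<in> ?E" "{w, c} \<in> ?E" "c \<noteq> a" "c \<noteq> b"
      for w a b c
      using that(1) unfolding V
    proof
      assume "w \<in> A ` ?I"
      then obtain i where "w = A i" "i \<in> ?I" by blast
      then show "a = b" using that EA[of i a] EA[of i b] EA[of i c] by auto
    next
      assume "w \<in> B ` I"
      then obtain i where "w = B i" "i \<in> I" by blast
      then show "a = b" using that EB[of i a] EB[of i b] EB[of i c] by auto
    qed
    note snoc = path_from_snoc[where V = ?V and E = ?E and v = Tap, OF _ _ _ _ start deg]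
    \<comment> \<open>The shape of \<open>p\<close> records that the water came through the pipe
      from Bob's side, so the next vertex on Alice's side is not the one before \<open>A a\<close>,
      as \<open>nonback\<close> demands.\<close>
    let ?arrival = "\<lambda>a p. path_from ?V ?E Tap p \<and> a \<in> ?I \<and>
      (a = None \<and> p = [Tap] \<or> (\<exists>i r. a = Some i \<and> p = r @ [B i, A a]))"
    have cross: "i \<in> I \<and> path_from ?V ?E Tap (p @ [A (Some i), B i])"
      if p: "?arrival a p" and i: "\<alpha> x a = Some i" "\<alpha> x a \<noteq> a" for a i p
    proof
      have l: "last p = A a" using p by (auto simp: A_def)
      show iI: "i \<in> I" using \<alpha>[of a x] p i by auto
      have p1: "path_from ?V ?E Tap (p @ [A (Some i)])"
      proof (rule snoc)
        show "{last p, A (Some i)} \<in> ?E" using EA[of a] p i l by auto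
        show "A (Some i) \<noteq> last p" using inj_onD[OF injA, of "\<alpha> x a" a] p i iI l by auto
        show "A (Some i) \<noteq> p ! (length p - 2)" if "2 \<le> length p"
          using p that AB by (auto simp: nth_append)
      qed (use p iI in \<open>auto simp: V\<close>)
      have "path_from ?V ?E Tap ((p @ [A (Some i)]) @ [B i])"
      proof (rule snoc[OF p1])
        have "(p @ [A (Some i)]) ! (length (p @ [A (Some i)]) - 2) = last p"
          using p by (auto simp: path_from_def nth_append last_conv_nth)
        then show "B i \<noteq> (p @ [A (Some i)]) ! (length (p @ [A (Some i)]) - 2)"
          using l AB[symmetric] by auto
      qed (use EA[of "Some i"] iI AB[symmetric] in \<open>auto simp: V\<close>)
      then show "path_from ?V ?E Tap (p @ [A (Some i), B i])" by simp
    qed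
    have return: "?arrival (Some (\<beta> y i)) ((p @ [A (Some i), B i]) @ [B (\<beta> y i), A (Some (\<beta> y i))])"
      if p: "path_from ?V ?E Tap (p @ [A (Some i), B i])" and i: "i \<in> I" "\<beta> y i \<noteq> i" for i p
    proof -
      have j: "\<beta> y i \<in> I" using \<beta> i by simp
      have p1: "path_from ?V ?E Tap ((p @ [A (Some i), B i]) @ [B (\<beta> y i)])"
        using i j EB[of i] AB inj_onD[OF injB, of "\<beta> y i" i]
        by (intro snoc[OF p]) (auto simp: V nth_append, metis AB)
      have "path_from ?V ?E Tap (((p @ [A (Some i), B i]) @ [B (\<beta> y i)]) @ [A (Some (\<beta> y i))])"
        using j EB[of "\<beta> y i"] AB 
        by (intro snoc[OF p1]) (auto simp: V nth_append)
      then show ?thesis using j by simp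
    qed
    have maxi: "\<exists>q. maximal_path_from ?V ?E Tap q \<and> last q \<in> (if b then B_vertices ?s else A0_vertices ?s)"
      if "outlet (\<alpha> x) (\<beta> y) a b" "?arrival a p" for a b p
      using that
    proof (induction arbitrary: p rule: outlet.induct)
      case (Alice a)
      have l: "last p = A a" using Alice by (auto simp: A_def)
      have "maximal_path_from ?V ?E Tap p"
        using Alice EA[of a] l by (intro maximal_path_fromI) auto
      moreover have "A a \<in> A0_vertices ?s" using Alice imA by blast
      ultimately show ?case using l by auto
    next
      case (Bob a i)
      note c = cross[OF Bob.prems Bob(1,2)]
      have "maximal_path_from ?V ?E Tap (p @ [A (Some i), B i])"
        using EB[of i] Bob(3) c by (intro maximal_path_fromI) auto
      moreover have "B i \<in> B_vertices ?s" using imB c by blast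
      ultimately show ?case by (intro exI[of _ "p @ [A (Some i), B i]"]) simp
    next
      case (flow a i b)
      note c = cross[OF flow.prems flow(1,2)]
      show ?case using flow.IH[OF return[of p i]] c flow(3) by blast
    qed
    have "path_from ?V ?E Tap [Tap]" by (auto simp: path_from_def V A_def)
    then obtain q where q: "maximal_path_from ?V ?E Tap q"
      "last q \<in> (if h x y then B_vertices ?s else A0_vertices ?s)"
      using maxi[OF h[OF lx ly], of "[Tap]"] by auto
    then have "water_path ?s G x y = q"
      unfolding water_path_def using ex1_maximal_path[OF game lx ly] by (intro the1_equality)
    then show "last (water_path ?s G x y) \<in> (if h x y then B_vertices ?s else A0_vertices ?s)"
      using q by simp
  qed
  then show ?thesis unfolding GH_def using game by (intro Least_le) blast
qed

section \<open>Games from layered programs\<close>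

text \<open>
  The forest has vertices \<open>(t, v)\<close> with \<open>t \<le> T\<close> and \<open>v < N\<close>, and \<open>(t + 1, f u)\<close> is the parent of
  \<open>(t, u)\<close>.  The points are positions of the tour: entering \<open>(t, v)\<close> from its parent (\<open>In t v\<close>),
  leaving \<open>(t, v)\<close> for its parent (\<open>Out t v\<close>), trying to descend from \<open>(t + 1, v)\<close> to \<open>(t, u)\<close>
  (\<open>Down t u v\<close>), and being back at \<open>(t + 1, v)\<close> after that (\<open>Up t u v\<close>).  The attempt fails, i.e.
  \<open>Down\<close> is matched with \<open>Up\<close>, if \<open>v \<noteq> f u\<close>.  As \<open>Out 0 c\<close> is
  linked to \<open>Start\<close>, the point \<open>In 0 c\<close> stays unlinked; a root stays unswitched.
\<close>

datatype point = Start | In nat nat | Out nat nat | Down nat nat nat | Up nat nat nat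

fun link :: "nat \<Rightarrow> nat \<Rightarrow> point \<Rightarrow> point" where
  "link N c Start = Out 0 c"
| "link N c (In 0 v) = (if v = c then In 0 v else Out 0 v)"
| "link N c (Out 0 v) = (if v = c then Start else In 0 v)"
| "link N c (In (Suc t) v) = Down t 0 v"
| "link N c (Down t 0 v) = In (Suc t) v"
| "link N c (Down t (Suc u) v) = Up t u v"
| "link N c (Up t u v) = (if Suc u < N then Down t (Suc u) v else Out (Suc t) v)"
| "link N c (Out (Suc t) v) = Up t (N - 1) v"

fun switch :: "nat \<Rightarrow> (nat \<Rightarrow> nat) \<Rightarrow> point \<Rightarrow> point" where
  "switch T f Start = Start"
| "switch T f (In t u) = (if t < T then Down t u (f u) else In t u)"
| "switch T f (Out t u) = (if t < T then Up t u (f u) else Out t u)"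
| "switch T f (Down t u v) = (if v = f u then In t u else Up t u v)"
| "switch T f (Up t u v) = (if v = f u then Out t u else Down t u v)"

text \<open>
  The tour ends at a root, which is unmatched.  Giving the accepting roots to Bob makes the water flow
  out on his side exactly there.
\<close>

fun bob_point :: "nat \<Rightarrow> (nat \<Rightarrow> bool) \<Rightarrow> (nat \<Rightarrow> bool) \<Rightarrow> point \<Rightarrow> bool" where
  "bob_point T bob acc Start = False"
| "bob_point T bob acc (In t u) = (if t < T then bob u else acc u)"
| "bob_point T bob acc (Out t u) = (if t < T then bob u else acc u)"
| "bob_point T bob acc (Down t u v) = bob u"
| "bob_point T bob acc (Up t u v) = bob u"

inductive_set points :: "nat \<Rightarrow> nat \<Rightarrow> point set" for N T where
  "Start \<in> points N T"
| "t \<le> T \<Longrightarrow> u < N \<Longrightarrow> In t u \<in> points N T"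
| "t \<le> T \<Longrightarrow> u < N \<Longrightarrow> Out t u \<in> points N T"
| "t < T \<Longrightarrow> u < N \<Longrightarrow> v < N \<Longrightarrow> Down t u v \<in> points N T"
| "t < T \<Longrightarrow> u < N \<Longrightarrow> v < N \<Longrightarrow> Up t u v \<in> points N T"

section \<open>Involutivity, ownership and number of the points\<close>

lemma in_points [simp]:
  "Start \<in> points N T"
  "In t u \<in> points N T \<longleftrightarrow> t \<le> T \<and> u < N"
  "Out t u \<in> points N T \<longleftrightarrow> t \<le> T \<and> u < N"
  "Down t u v \<in> points N T \<longleftrightarrow> t < T \<and> u < N \<and> v < N"
  "Up t u v \<in> points N T \<longleftrightarrow> t < T \<and> u < N \<and> v < N"
  by (auto intro: points.intros elim: points.cases)

lemma link_points:
  assumes "d \<in> points N T" "c < N"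
  shows "link N c d \<in> points N T \<and> link N c (link N c d) = d"
  using assms
proof (induction N c d rule: link.induct)
  case (8 N c t v)
  then show ?case by (cases N) auto
qed auto

lemma switch_points:
  assumes "d \<in> points N T" "\<And>u. u < N \<Longrightarrow> f u < N"
  shows "switch T f d \<in> points N T \<and> switch T f (switch T f d) = d"
  using assms by (cases d) auto

text \<open>Needed so that every edge of the input-dependent matching belongs to a single player.
  \<open>switch\<close> keeps the layer and the index \<open>u\<close>, and \<open>Down\<close> and
  \<open>Up\<close> occur only for \<open>t < T\<close>, where \<open>bob u\<close> decides for all
  kinds of points.\<close>

lemma bob_point_switch:
  "d \<in> points N T \<Longrightarrow> bob_point T bob acc (switch T f d) = bob_point T bob acc d"
  by (cases d) auto

lemma points_card:
  "finite (points N T) \<and> card (points N T) \<le> 1 + 2 * (T + 1) * N + 2 * T * N * N"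
proof -
  let ?D = "{..T} \<times> {..<N}" and ?E = "{..<T} \<times> {..<N} \<times> {..<N}"
  have eq: "points N T = insert Start ((\<lambda>(t, u). In t u) ` ?D \<union> (\<lambda>(t, u). Out t u) ` ?D
      \<union> ((\<lambda>(t, u, v). Down t u v) ` ?E \<union> (\<lambda>(t, u, v). Up t u v) ` ?E))"
    (is "_ = insert Start (?A \<union> ?B \<union> (?C \<union> ?F))")
  proof (rule set_eqI)
    show "d \<in> points N T \<longleftrightarrow> d \<in> insert Start (?A \<union> ?B \<union> (?C \<union> ?F))" for d
      by (cases d) (auto simp: image_iff)
  qed
  have "card ?A \<le> (T + 1) * N" "card ?B \<le> (T + 1) * N"
    using card_image_le[of ?D "\<lambda>(t, u). In t u"] card_image_le[of ?D "\<lambda>(t, u). Out t u"]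
    by (simp_all add: card_cartesian_product)
  moreover have "card ?C \<le> T * N * N" "card ?F \<le> T * N * N"
    using card_image_le[of ?E "\<lambda>(t, u, v). Down t u v"] card_image_le[of ?E "\<lambda>(t, u, v). Up t u v"]
    by (simp_all add: card_cartesian_product mult.assoc)
  moreover have "card (points N T) \<le> 1 + card (?A \<union> ?B \<union> (?C \<union> ?F))"
    unfolding eq by (simp add: card_insert_if)
  moreover have "card (?A \<union> ?B \<union> (?C \<union> ?F)) \<le> card (?A \<union> ?B) + card (?C \<union> ?F)"
    by (rule card_Un_le)
  moreover have "card (?A \<union> ?B) \<le> card ?A + card ?B" "card (?C \<union> ?F) \<le> card ?C + card ?F"
    by (rule card_Un_le)+
  ultimately have "card (points N T) \<le> 1 + 2 * (T + 1) * N + 2 * T * N * N" by linarith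
  then show ?thesis unfolding eq by auto
qed

section \<open>The Euler tour and its end at the root\<close>

definition tour :: "nat \<Rightarrow> nat \<Rightarrow> nat \<Rightarrow> (nat \<Rightarrow> nat) \<Rightarrow> point \<Rightarrow> point \<Rightarrow> bool" where
  "tour N T c f d e \<longleftrightarrow> d \<in> points N T \<and> switch T f d \<noteq> d \<and>
     link N c (switch T f d) \<noteq> switch T f d \<and> e = link N c (switch T f d)"

context
  fixes N T c :: nat and f :: "nat \<Rightarrow> nat"
  assumes c: "c < N" and f: "\<And>u. u < N \<Longrightarrow> f u < N"
begin

private definition reach where "reach = (tour N T c f)\<^sup>*\<^sup>*"
text \<open>The position in the sweep over the candidate children of \<open>(t + 1, v)\<close> in
  which \<open>u\<close> is tried next; at \<open>u = N\<close> all of them have been tried.\<close>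

private definition down where "down t v u = (if u < N then Down t u v else Out (Suc t) v)"
private abbreviation orbit where "orbit t \<equiv> (f ^^ t) c"

private lemma orbit_less: "orbit t < N"
  using c f by (induction t) auto

private lemma reach_trans [trans]: "reach d e \<Longrightarrow> reach e e' \<Longrightarrow> reach d e'"
  by (simp add: reach_def)

private lemma tour_reach: "tour N T c f d e \<Longrightarrow> reach d e"
  by (simp add: reach_def)

private lemma reach_Up:
  assumes "t < T" "u < N" "v < N" "d \<in> points N T" "switch T f d = Up t u v" "d \<noteq> Up t u v"
  shows "reach d (down t v (Suc u))"
  using assms by (intro tour_reach) (auto simp: tour_def down_def)

text \<open>
  Only off the orbit of \<open>c\<close> does the tour of a subtree return to its top, since \<open>In 0 c\<close> is open.
  Coming from \<open>(t, orbit t)\<close>, the sweep starts after that child, so it does not need to return from it.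
\<close>

private lemma sweep:
  assumes visit: "\<And>u. u < N \<Longrightarrow> u \<noteq> orbit t \<Longrightarrow>
      reach (link N c (In t u)) (Out t u) \<and> link N c (In t u) \<noteq> In t u"
    and t: "t < T" and v: "v < N"
    and skip: "v = orbit (Suc t) \<Longrightarrow> orbit t < i" and "i \<le> N"
  shows "reach (down t v i) (Out (Suc t) v)"
  using \<open>i \<le> N\<close> skip
proof (induction i rule: inc_induct)
  case base
  then show ?case by (simp add: down_def reach_def)
next
  case (step u)
  have "reach (down t v u) (down t v (Suc u))"
  proof (cases "v = f u")
    case True
    \<comment> \<open>Otherwise \<open>v = f u\<close> would be \<open>orbit (Suc t)\<close>, and
      then \<open>skip\<close> places the sweep beyond \<open>orbit t\<close>.\<close>
    then have u: "u \<noteq> orbit t" using step.prems by auto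
    have "reach (down t v u) (link N c (In t u))"
      using True step.hyps t v visit[OF _ u] by (intro tour_reach) (auto simp: tour_def down_def)
    also have "reach \<dots> (Out t u)" using visit[OF _ u] step.hyps by blast
    also have "reach \<dots> (down t v (Suc u))"
      using True step.hyps t v by (intro reach_Up) auto
    finally show ?thesis .
  next
    case False
    then show ?thesis
      using step.hyps t v by (intro reach_Up) (auto simp: down_def)
  qed
  also have "reach \<dots> (Out (Suc t) v)" using step.IH step.prems less_SucI by blast
  finally show ?case .
qed

private lemma visit:
  "t \<le> T \<Longrightarrow> v < N \<Longrightarrow> v \<noteq> orbit t \<Longrightarrow>
    reach (link N c (In t v)) (Out t v) \<and> link N c (In t v) \<noteq> In t v"
proof (induction t arbitrary: v)
  case 0
  then show ?case by (simp add: reach_def)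
next
  case (Suc t)
  \<comment> \<open>Off the orbit \<open>skip\<close> is vacuous, so the sweep can start at 0. Since
    \<open>c < N\<close> gives \<open>0 < N\<close>, \<open>down t v 0\<close> is the link of
    \<open>In (Suc t) v\<close>.\<close>
  have "reach (down t v 0) (Out (Suc t) v)"
    using Suc by (intro sweep) auto
  then show ?case using c Suc by (auto simp: down_def)
qed

text \<open>Each layer takes one climb from the orbit vertex to its parent and a sweep over the
  later candidates. These lie off the orbit, so the tour comes back from the subtree of each child
  among them.\<close>

lemma tour_orbit: "t \<le> T \<Longrightarrow> (tour N T c f)\<^sup>*\<^sup>* (Out 0 c) (Out t ((f ^^ t) c))"
  unfolding reach_def[symmetric]
proof (induction t)
  case 0
  show ?case by (simp add: reach_def)
next
  case (Suc t)
  then have "reach (Out 0 c) (Out t (orbit t))" by simp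
  also have "reach \<dots> (down t (orbit (Suc t)) (Suc (orbit t)))"
    using Suc orbit_less[of t] f by (intro reach_Up) auto
  also have "reach \<dots> (Out (Suc t) (orbit (Suc t)))"
    using Suc orbit_less[of t] orbit_less[of "Suc t"] visit[of t] by (intro sweep) auto
  finally show ?case .
qed

end

text \<open>
  The front pipe of a point has the point on Alice's side and carries the fixed matching on Bob's
  side.  For a point controlled by Bob, Alice extends it by the back pipe, which brings it to Bob.
\<close>

datatype pipe = Front point | Back point

text \<open>The factor 2 counts the front and back pipe of each point. The \<open>T\<close> layers
  unroll the transition map, whose own graph may have cycles, into a forest.\<close>

theorem GH_le_layered_program:
  fixes next_A next_B :: "bool list \<Rightarrow> nat \<Rightarrow> nat"
  assumes c: "c < N"
    and next_A: "\<And>x u. u < N \<Longrightarrow> next_A x u < N" and next_B: "\<And>y u. u < N \<Longrightarrow> next_B y u < N"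
    and h: "\<And>x y. length x = n \<Longrightarrow> length y = n \<Longrightarrow>
      h x y = acc (((\<lambda>u. if bob u then next_B y u else next_A x u) ^^ T) c)"
  shows "GH n h \<le> 2 * (1 + 2 * (T + 1) * N + 2 * T * N * N)"
proof -
  let ?bob = "bob_point T bob acc" and ?P = "points N T"
  let ?I = "Front ` ?P \<union> Back ` ?P"
  \<comment> \<open>The tap feeds \<open>Front Start\<close>. The back pipe of a point of Alice is
    open at both ends.\<close>
  define \<alpha> where "\<alpha> x a = (case a of
      None \<Rightarrow> Some (Front Start)
    | Some (Front d) \<Rightarrow> if d = Start then None
        else if ?bob d then Some (Back d) else Some (Front (switch T (next_A x) d))
    | Some (Back d) \<Rightarrow> if ?bob d then Some (Front d) else Some (Back d))" for x a
  define \<beta> where "\<beta> y i = (case i of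
      Front d \<Rightarrow> Front (link N c d)
    | Back d \<Rightarrow> Back (if ?bob d then switch T (next_B y) d else d))" for y i
  have "GH n h \<le> card ?I"
  proof (rule GH_le_involutions)
    show "finite ?I" using points_card by blast
    show "\<alpha> x a \<in> insert None (Some ` ?I) \<and> \<alpha> x (\<alpha> x a) = a" if a: "a \<in> insert None (Some ` ?I)" for x a
    proof -
      have *: "switch T (next_A x) d \<noteq> Start" if "d \<in> ?P" "d \<noteq> Start" for d
        using that by (cases d) auto
      consider "a = None" | d where "a = Some (Front d)" "d \<in> ?P" | d where "a = Some (Back d)" "d \<in> ?P"
        using a by blast
      then show ?thesis
      proof cases
        case (2 d)
        then show ?thesis
          using switch_points[OF 2(2), of "next_A x"] next_A bob_point_switch[OF 2(2)] *[of d] by (simp add: \<alpha>_def)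
      next
        case (3 d)
        then show ?thesis by (cases "d = Start"; cases "?bob d") (simp_all add: \<alpha>_def)
      qed (simp add: \<alpha>_def)
    qed
    show "\<beta> y i \<in> ?I \<and> \<beta> y (\<beta> y i) = i" if "i \<in> ?I" for y i
      using that link_points[OF _ c] switch_points[where f="next_B y", OF _ next_B] bob_point_switch
      by (auto simp: \<beta>_def)
    fix x y :: "bool list" assume l: "length x = n" "length y = n"
    define f where "f u = (if bob u then next_B y u else next_A x u)" for u
    have f: "u < N \<Longrightarrow> f u < N" for u using next_A next_B by (auto simp: f_def)
    \<comment> \<open>\<open>switch\<close> consults \<open>f\<close> only at the index of the
      point, hence only the owner's transition; roots are fixed whatever the transition is.\<close>
    have sw: "switch T f d = switch T (if ?bob d then next_B y else next_A x) d" for d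
      by (cases d) (auto simp: f_def)
    have unwind: "outlet (\<alpha> x) (\<beta> y) (Some (Front d)) b"
      if "tour N T c f d e" "outlet (\<alpha> x) (\<beta> y) (Some (Front e)) b" for d e b
    proof -
      let ?d = "switch T f d"
      have d: "d \<in> ?P" "?d \<noteq> d" "link N c ?d \<noteq> ?d" "e = link N c ?d"
        using that by (auto simp: tour_def)
      have s: "d \<noteq> Start" "?d \<noteq> Start" using d(1,2) by (cases d; auto)+
      have B: "\<beta> y (Front ?d) = Front e" "e \<noteq> ?d" using d(3,4) by (simp_all add: \<beta>_def)
      show ?thesis
      \<comment> \<open>For a point of Bob one tour step takes two passages: along the back pipes to
        Bob's switch and back, then along the front pipe of \<open>?d\<close> to the fixed matching.
        For a point of Alice it takes one.\<close>
      proof (cases "?bob d")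
        case True
        then have "?bob ?d" using bob_point_switch d by blast
        then have bd: "\<alpha> x (Some (Back ?d)) = Some (Front ?d)" by (simp add: \<alpha>_def)
        have b: "outlet (\<alpha> x) (\<beta> y) (Some (Back ?d)) b"
          by (rule outlet.flow[where i = "Front ?d"]) (use bd B that(2) in \<open>simp_all\<close>)
        have fd: "\<alpha> x (Some (Front d)) = Some (Back d)" "\<beta> y (Back d) = Back ?d"
          using True s sw[of d] by (simp_all add: \<alpha>_def \<beta>_def)
        show ?thesis
          by (rule outlet.flow[where i = "Back d"]) (use fd b d(2) in \<open>simp_all\<close>)
      next
        case False
        then have fd: "\<alpha> x (Some (Front d)) = Some (Front ?d)"
          using s sw[of d] by (simp add: \<alpha>_def)
        show ?thesis
          by (rule outlet.flow[where i = "Front ?d"]) (use fd B that(2) d(2) in \<open>simp_all\<close>)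
      qed
    qed
    have unwinds: "outlet (\<alpha> x) (\<beta> y) (Some (Front d)) b"
      if "(tour N T c f)\<^sup>*\<^sup>* d e" "outlet (\<alpha> x) (\<beta> y) (Some (Front e)) b" for d e b
      using that by (induction rule: converse_rtranclp_induct) (auto intro: unwind)
    let ?u = "(f ^^ T) c"
    have final: "outlet (\<alpha> x) (\<beta> y) (Some (Front (Out T ?u))) (acc ?u)"
    proof (cases "acc ?u")
      case True
      then show ?thesis
        using outlet.Bob[of "\<alpha> x" "Some (Front (Out T ?u))" "Back (Out T ?u)" "\<beta> y"]
        by (auto simp: \<alpha>_def \<beta>_def)
    next
      case False
      then show ?thesis
        using outlet.Alice[of "\<alpha> x" "Some (Front (Out T ?u))" "\<beta> y"] by (auto simp: \<alpha>_def)
    qed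
    have "(tour N T c f)\<^sup>*\<^sup>* (Out 0 c) (Out T ?u)"
      by (rule tour_orbit) (simp_all add: c f)
    note first = unwinds[OF this final]
    have "outlet (\<alpha> x) (\<beta> y) None (acc ?u)"
      by (rule outlet.flow[where i = "Front Start"]) (use first in \<open>simp_all add: \<alpha>_def \<beta>_def\<close>)
    moreover have "h x y = acc ?u" using h[OF l] by (simp add: f_def[abs_def])
    ultimately show "outlet (\<alpha> x) (\<beta> y) None (h x y)" by simp
  qed
  also have "card ?I \<le> card ?P + card ?P"
    using points_card by (meson card_Un_le card_image_le add_mono order.trans)
  also have "\<dots> \<le> 2 * (1 + 2 * (T + 1) * N + 2 * T * N * N)"
    using points_card[of N T] by simp
  finally show ?thesis .
qed

section \<open>Space-bounded Turing machines as layered programs\<close>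

text \<open>Tapes are total functions, so blanks beyond cell \<open>s\<close> are imposed to keep
  the set finite.\<close>

definition confs :: "tm \<Rightarrow> nat \<Rightarrow> nat \<Rightarrow> config set" where
  "confs M m s = {c. state c < num_states M \<and> input_pos c \<le> m + 1 \<and> work_pos c < s \<and>
     (\<forall>i<s. work_tape c i < num_symbols M) \<and> (\<forall>i\<ge>s. work_tape c i = 0)}"

lemma card_confs:
  "finite (confs M m s) \<and> card (confs M m s) \<le> num_states M * (m + 2) * (2 * num_symbols M) ^ s"
proof -
  let ?k = "num_symbols M"
  let ?D = "{..<num_states M} \<times> {..m + 1} \<times> {..<s} \<times> ({..<s} \<rightarrow>\<^sub>E {..<?k})"
  let ?f = "\<lambda>(q, i, j, g). \<lparr>state = q, input_pos = i, work_tape = \<lambda>l. if l < s then g l else 0, work_pos = j\<rparr>"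
  have sub: "confs M m s \<subseteq> ?f ` ?D"
  proof
    fix c assume c: "c \<in> confs M m s"
    let ?t = "(state c, input_pos c, work_pos c, restrict (work_tape c) {..<s})"
    have "c = ?f ?t" using c by (auto simp: confs_def intro!: config.equality)
    moreover have "?t \<in> ?D" using c by (auto simp: confs_def)
    ultimately show "c \<in> ?f ` ?D" by blast
  qed
  have fin: "finite ?D" by (intro finite_cartesian_product finite_PiE) auto
  have "card (confs M m s) \<le> card ?D"
    using card_mono[OF finite_imageI[OF fin] sub] card_image_le[OF fin, of ?f] by linarith
  also have "\<dots> = num_states M * ((m + 2) * (s * ?k ^ s))"
    by (simp add: card_cartesian_product card_PiE)
  \<comment> \<open>\<open>s \<le> 2 ^ s\<close> absorbs the work-head position into the
    power.\<close>
  also have "\<dots> \<le> num_states M * ((m + 2) * (2 ^ s * ?k ^ s))"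
    by (intro mult_le_mono) (auto intro: less_imp_le)
  also have "\<dots> = num_states M * (m + 2) * (2 * ?k) ^ s"
    by (simp only: power_mult_distrib mult.assoc)
  finally show ?thesis
    using finite_subset[OF sub finite_imageI[OF fin]] by blast
qed

lemma run_Suc: "run M w (Suc t) = tm_step M w (run M w t)"
  by (simp add: run_def)

lemma run_halted:
  assumes "halted M (run M w t)" "t \<le> t'"
  shows "run M w t' = run M w t"
  using assms(2,1) by (induction t' rule: dec_induct) (auto simp: run_Suc tm_step_def)

lemma run_shift: "run M w i = run M w j \<Longrightarrow> run M w (i + l) = run M w (j + l)"
  by (induction l) (auto simp: run_Suc)

lemma run_in_confs:
  assumes M: "valid_tm M" and S: "space_bounded M S"
  shows "run M w t \<in> confs M (length w) (S (length w))"
proof (induction t)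
  case 0
  then show ?case
    using M S[unfolded space_bounded_def, rule_format, of w 0]
    by (auto simp: confs_def run_def initial_config_def valid_tm_def)
next
  case (Suc t)
  let ?c = "run M w t"
  have pos: "work_pos (run M w (Suc t)) < S (length w)"
    using S by (auto simp: space_bounded_def)
  show ?case
  proof (cases "halted M ?c")
    case True
    then show ?thesis using Suc by (simp add: run_Suc tm_step_def)
  next
    case False
    obtain q b d e where \<delta>: "delta M (state ?c) (read_input w (input_pos ?c)) (work_tape ?c (work_pos ?c)) = (q, b, d, e)"
      by (metis prod_cases4)
    have M': "case delta M q a b of (q', b', d, e) \<Rightarrow> q' < num_states M \<and> b' < num_symbols M"
      if "q < num_states M" "b < num_symbols M" for q a b
      using M that by (simp add: valid_tm_def)
    have "state ?c < num_states M" "work_tape ?c (work_pos ?c) < num_symbols M"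
      using Suc by (auto simp: confs_def)
    from M'[OF this, of "read_input w (input_pos ?c)"]
    have "q < num_states M \<and> b < num_symbols M" by (simp add: \<delta>)
    then show ?thesis
      using Suc False pos \<delta> by (auto simp: confs_def run_Suc tm_step_def)
  qed
qed

text \<open>Pigeonhole: up to the first halting time all configurations differ, since cutting out a
  loop would give an earlier halt.\<close>

lemma halted_after_card:
  assumes fin: "finite C" and C: "\<And>t. run M w t \<in> C" and "halted M (run M w t)"
  shows "halted M (run M w (card C))"
proof -
  define t0 where "t0 = (LEAST t. halted M (run M w t))"
  have t0: "halted M (run M w t0)" unfolding t0_def using assms(3) by (rule LeastI)
  have least: "\<not> halted M (run M w t)" if "t < t0" for t
    using that not_less_Least unfolding t0_def by blast
  have "inj_on (run M w) {..t0}"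
  proof (rule linorder_inj_onI')
    fix i j assume ij: "i \<in> {..t0}" "j \<in> {..t0}" "i < j"
    show "run M w i \<noteq> run M w j"
    proof
      assume "run M w i = run M w j"
      then have "run M w (i + (t0 - j)) = run M w t0" using run_shift[of M w i j "t0 - j"] ij by simp
      moreover have "i + (t0 - j) < t0" using ij by auto
      ultimately show False using t0 least by metis
    qed
  qed
  then have "card {..t0} \<le> card C" using C fin by (intro card_inj_on_le) auto
  then show ?thesis using run_halted[OF t0, of "card C"] t0 by simp
qed

lemma tm_step_local:
  assumes "length w = length w'" "read_input w (input_pos c) = read_input w' (input_pos c)"
  shows "tm_step M w c = tm_step M w' c"
  using assms by (simp add: tm_step_def)

text \<open>Numbered configurations are the program states, and by \<open>halted_after_card\<close>
  as many layers as configurations suffice. Each player computes transitions on an input whose other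
  half is padded with \<open>False\<close>, which is correct while the head reads the player's own
  half.\<close>

lemma GH_le_space:
  assumes M: "valid_tm M" and dec: "decides M (decision_problem f)" and S: "space_bounded M S"
    and n: "1 \<le> n"
  defines "N \<equiv> card (confs M (2 * n) (S (2 * n)))"
  shows "0 < N \<and> GH n (f n) \<le> 2 * (1 + 2 * (N + 1) * N + 2 * N * N * N)"
proof -
  let ?C = "confs M (2 * n) (S (2 * n))"
  have fin: "finite ?C" using card_confs by blast
  have run: "run M w t \<in> ?C" if "length w = 2 * n" for w t
    using run_in_confs[OF M S, of w t] that by simp
  have init: "initial_config M \<in> ?C"
    using run[of "replicate (2 * n) False" 0] by (simp add: run_def)
  obtain e where e: "bij_betw e ?C {0..<N}"
    using ex_bij_betw_finite_nat[OF fin] by (auto simp: N_def)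
  define d where "d = inv_into ?C e"
  have d: "d u \<in> ?C" if "u < N" for u
    using bij_betw_apply[OF bij_betw_inv_into[OF e], of u] that by (simp add: d_def)
  have ed: "e c < N" "d (e c) = c" if "c \<in> ?C" for c
    using bij_betw_apply[OF e that] bij_betw_inv_into_left[OF e that] by (auto simp: d_def)
  \<comment> \<open>A configuration that does not occur in the run on \<open>w\<close> may step out
    of \<open>?C\<close>; letting it stay put keeps all successors below \<open>N\<close>.\<close>
  define g where "g w c = (if tm_step M w c \<in> ?C then tm_step M w c else c)" for w c
  define F where "F w u = e (g w (d u))" for w u
  have F: "F w u < N" if "u < N" for w u
    using d[OF that] ed by (auto simp: F_def g_def)
  \<comment> \<open>Cell 0 holds the left marker, so \<open>x\<close> occupies the cells 1 to
    \<open>n\<close>. The two markers do not depend on the input bits.\<close>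
  define bob where "bob u \<longleftrightarrow> n < input_pos (d u)" for u
  define acc where "acc u \<longleftrightarrow> state (d u) = accept_state M" for u
  let ?pad = "replicate n False"
  have orbit: "(F w ^^ t) (e (initial_config M)) = e (run M w t)" if "length w = 2 * n" for w t
  proof (induction t)
    case (Suc t)
    then show ?case
      using run[OF that, of t] run[OF that, of "Suc t"] ed by (simp add: F_def g_def run_Suc)
  qed (simp add: run_def)
  have "GH n (f n) \<le> 2 * (1 + 2 * (N + 1) * N + 2 * N * N * N)"
  proof (rule GH_le_layered_program[where next_A = "\<lambda>x. F (x @ ?pad)" and next_B = "\<lambda>y. F (?pad @ y)"
        and bob = bob and acc = acc and c = "e (initial_config M)"])
    fix x y :: "bool list" assume l: "length x = n" "length y = n"
    let ?w = "x @ y"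
    have lw: "length ?w = 2 * n" using l by simp
    have "(if bob u then F (?pad @ y) u else F (x @ ?pad) u) = F ?w u" for u
    proof (cases "bob u")
      case True
      then have "tm_step M (?pad @ y) (d u) = tm_step M ?w (d u)"
        by (intro tm_step_local) (auto simp: l read_input_def nth_append bob_def)
      then show ?thesis using True by (simp add: F_def g_def)
    next
      case False
      then have "tm_step M (x @ ?pad) (d u) = tm_step M ?w (d u)"
        by (intro tm_step_local) (auto simp: l read_input_def nth_append bob_def)
      then show ?thesis using False by (simp add: F_def g_def)
    qed
    then have "acc (((\<lambda>u. if bob u then F (?pad @ y) u else F (x @ ?pad) u) ^^ N) (e (initial_config M)))
        \<longleftrightarrow> state (run M ?w N) = accept_state M"
      using orbit[OF lw] ed run[OF lw] by (simp add: acc_def)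
    also have "\<dots> \<longleftrightarrow> (\<exists>t. state (run M ?w t) = accept_state M)"
    proof
      assume "\<exists>t. state (run M ?w t) = accept_state M"
      then obtain t where t: "state (run M ?w t) = accept_state M" by blast
      then have h: "halted M (run M ?w t)" by (simp add: halted_def)
      have hN: "halted M (run M ?w N)"
        unfolding N_def using h run[OF lw] fin by (intro halted_after_card[where t = t])
      show "state (run M ?w N) = accept_state M"
        using run_halted[OF h, of "max t N"] run_halted[OF hN, of "max t N"] t by simp
    qed blast
    also have "\<dots> \<longleftrightarrow> ?w \<in> decision_problem f"
      using dec by (auto simp: decides_def)
    also have "\<dots> \<longleftrightarrow> f n x y"
    proof
      assume "?w \<in> decision_problem f"
      then obtain n' x' y' where "?w = x' @ y'" "length x' = n'" "length y' = n'" "f n' x' y'"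
        by (auto simp: decision_problem_def)
      moreover from this have "n' = n" using lw by (metis length_append mult_2 nat_mult_eq_cancel_disj zero_neq_numeral)
      ultimately show "f n x y" using l by simp
    qed (use l n in \<open>auto simp: decision_problem_def\<close>)
    finally show "f n x y = acc (((\<lambda>u. if bob u then F (?pad @ y) u else F (x @ ?pad) u) ^^ N) (e (initial_config M)))"
      by simp
  qed (use F ed init in auto)
  then show ?thesis using init fin by (auto simp: N_def card_gt_0_iff)
qed

section \<open>From logarithmic space to polynomial size\<close>

lemma power_log_le_poly:
  fixes S :: "nat \<Rightarrow> nat" and b :: nat
  assumes "(\<lambda>n. real (S n)) \<in> O(\<lambda>n. ln (real n))" and b: "1 \<le> b"
  shows "\<exists>e. \<forall>m\<ge>2. b ^ S m \<le> m ^ e"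
proof -
  obtain C where "eventually (\<lambda>n. norm (real (S n)) \<le> C * norm (ln (real n))) sequentially"
    using assms(1) by (elim landau_o.bigE)
  then obtain m0 where m0: "\<And>m. m \<ge> m0 \<Longrightarrow> norm (real (S m)) \<le> C * norm (ln (real m))"
    by (auto simp: eventually_sequentially)
  \<comment> \<open>The sum covers the finitely many lengths below \<open>m0\<close>; dividing it by
    \<open>ln 2\<close> suffices because \<open>ln m \<ge> ln 2\<close> for
    \<open>m \<ge> 2\<close>.\<close>
  define K where "K = max C ((\<Sum>m<m0. real (S m)) / ln 2)"
  \<comment> \<open>Chosen for \<open>exp (K * ln m * ln b) \<le> m ^ e\<close>.\<close>
  define e where "e = nat \<lceil>K * ln b\<rceil>"
  have K: "real (S m) \<le> K * ln m" if "m \<ge> 2" for m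
  proof (cases "m \<ge> m0")
    case True
    have "real (S m) \<le> C * ln m" using m0[OF True] that by simp
    also have "\<dots> \<le> K * ln m" using that by (intro mult_right_mono) (auto simp: K_def)
    finally show ?thesis .
  next
    case False
    let ?s = "\<Sum>m<m0. real (S m)"
    have "real (S m) \<le> ?s" using False by (intro member_le_sum) auto
    also have "?s = ?s / ln 2 * ln 2" by simp
    also have "\<dots> \<le> ?s / ln 2 * ln m"
      using that by (intro mult_left_mono divide_nonneg_nonneg sum_nonneg) auto
    also have "\<dots> \<le> K * ln m" using that by (intro mult_right_mono) (auto simp: K_def)
    finally show ?thesis .
  qed
  have "b ^ S m \<le> m ^ e" if m: "m \<ge> 2" for m
  proof -
    have "real b ^ S m = exp (real (S m) * ln b)" using b by (simp add: exp_of_nat_mult)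
    also have "real (S m) * ln b \<le> K * ln m * ln b"
      using K[OF m] b by (intro mult_right_mono) auto
    also have "K * ln m * ln b \<le> real e * ln m"
      using m of_nat_ceiling[of "K * ln b"] mult_right_mono[of "K * ln b" "real e" "ln m"]
      by (simp add: e_def mult_ac)
    also have "exp (real e * ln m) = real m ^ e" using m by (simp add: exp_of_nat_mult)
    finally have "real (b ^ S m) \<le> real (m ^ e)" by simp
    then show ?thesis by (simp only: of_nat_le_iff)
  qed
  then show ?thesis by blast
qed

theorem LOGSPACE_imp_polynomial_GH:
  assumes "decision_problem f \<in> LOGSPACE"
  shows "\<not> superpolynomial_GH f"
proof -
  obtain M S where M: "valid_tm M" "decides M (decision_problem f)" "space_bounded M S"
    and S: "(\<lambda>n. real (S n)) \<in> O(\<lambda>n. ln (real n))"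
    using assms by (auto simp: LOGSPACE_def)
  have "1 \<le> 2 * num_symbols M" using M(1) by (auto simp: valid_tm_def)
  then obtain e where e: "\<And>m. m \<ge> 2 \<Longrightarrow> (2 * num_symbols M) ^ S m \<le> m ^ e"
    using power_log_le_poly[OF S] by blast
  \<comment> \<open>The bound of \<open>GH_le_space\<close> expands to
    \<open>2 + 4 * N + 4 * N ^ 2 + 4 * N ^ 3\<close>, at most \<open>14 * N ^ 3\<close> as
    \<open>N \<ge> 1\<close>. The base of the cube is the bound on \<open>N\<close>, with
    \<open>(2 * n) ^ e\<close> written as \<open>2 ^ e * n ^ e\<close>.\<close>
  define p where "p = smult 14 (([:2 * num_states M, 2 * num_states M:] * monom (2 ^ e) e) ^ 3)"
  have "GH n (f n) \<le> poly p n" if n: "n \<ge> 1" for n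
  proof -
    define N where "N = card (confs M (2 * n) (S (2 * n)))"
    have N: "0 < N" "GH n (f n) \<le> 2 * (1 + 2 * (N + 1) * N + 2 * N * N * N)"
      using GH_le_space[OF M n] by (auto simp: N_def)
    have "N \<le> num_states M * (2 * n + 2) * (2 * num_symbols M) ^ S (2 * n)"
      using card_confs[of M "2 * n"] unfolding N_def by blast
    also have "\<dots> \<le> num_states M * (2 * n + 2) * (2 * n) ^ e"
      using e[of "2 * n"] n by (intro mult_le_mono2) auto
    finally have NB: "N \<le> num_states M * (2 * n + 2) * (2 * n) ^ e" (is "N \<le> ?B") .
    have "1 \<le> N ^ 3" "N \<le> N ^ 3" "N ^ 2 \<le> N ^ 3"
      using N(1) by (auto intro: self_le_power power_increasing)
    moreover have "2 * (1 + 2 * (N + 1) * N + 2 * N * N * N) = 2 + 4 * N + 4 * N ^ 2 + 4 * N ^ 3"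
      by (simp add: algebra_simps power2_eq_square power3_eq_cube)
    ultimately have "2 * (1 + 2 * (N + 1) * N + 2 * N * N * N) \<le> 14 * N ^ 3" by linarith
    also have "\<dots> \<le> 14 * ?B ^ 3" using NB by (intro mult_le_mono2 power_mono) auto
    also have "\<dots> = poly p n"
      by (simp add: p_def poly_monom power_mult_distrib algebra_simps)
    finally show ?thesis using N(2) by linarith
  qed
  then show ?thesis by (auto simp: superpolynomial_GH_def)
qed

theorem corollary4p7:
  assumes "\<exists>f :: nat \<Rightarrow> bool list \<Rightarrow> bool list \<Rightarrow> bool.
             decision_problem f \<in> PTIME \<and> superpolynomial_GH f"
  shows "PTIME \<noteq> LOGSPACE"
  using assms LOGSPACE_imp_polynomial_GH by blast

end
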